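(* A semi-C-reducible Finsler space $(M,L)$ satisfying the b-condition $b^iC_{ijk}=0$ is either Riemannian or $C_2$-like.
   Context: $(M,L)$ is an $n$-dimensional smooth Finsler manifold; $\dot\partial_i=\partial/\partial y^i$, $g_{ij}=\frac12\dot\partial_i\dot\partial_jL^2$, $l_i=\dot\partial_iL$, $y_i=g_{ij}y^j$, $h_{ij}=g_{ij}-l_il_j$, $C_{ijk}=\frac12\dot\partial_kg_{ij}$, $C_i=C_{ijk}g^{jk}$, $C^2=g^{ij}C_iC_j$. A 1-form $b_i(x)dx^i$ on $M$ is given, with $\beta=b_iy^i$, $b^i=g^{ij}b_j$, and it is assumed that $m_i:=b_i-(\beta/L^2)y_i\neq0$ and $m^2:=g^{ij}m_im_j\ne0$ at the points under consideration. For $n\ge3$, $(M,L)$ is semi-C-reducible if $C_{ijk}=\frac{r}{n+1}(h_{ij}C_k+h_{ki}C_j+h_{jk}C_i)+\frac{t}{C^2}C_iC_jC_k$ with scalar functions $r,t$, $r+t=1$. $(M,L)$ is $C_2$-like if $C^2C_{ijk}=C_iC_jC_k$, and Riemannian if $C_{ijk}=0$. *)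

theory Defs
  imports "HOL-Analysis.Analysis"
begin

section \<open>Smooth maps and smooth manifolds\<close>

primrec Ck_on ::
  "nat \<Rightarrow> 'a::euclidean_space set \<Rightarrow> ('a \<Rightarrow> 'b::real_normed_vector) \<Rightarrow> bool" where
  "Ck_on 0 S f \<longleftrightarrow> continuous_on S f"
| "Ck_on (Suc k) S f \<longleftrightarrow>
     (\<forall>x\<in>S. f differentiable (at x)) \<and>
     (\<forall>e\<in>Basis. Ck_on k S (\<lambda>x. frechet_derivative f (at x) e))"

text \<open>Only used for open \<open>S\<close>.\<close>

definition smooth_on :: "'a::euclidean_space set \<Rightarrow> ('a \<Rightarrow> 'b::real_normed_vector) \<Rightarrow> bool" where
  "smooth_on S f \<longleftrightarrow> (\<forall>k. Ck_on k S f)"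

text \<open>A chart is its domain together with its coordinate map; the dimension of the manifold is
  \<open>CARD('n)\<close>.\<close>

type_synonym ('m, 'n) chart = "'m set \<times> ('m \<Rightarrow> real ^ 'n)"

definition is_chart :: "'m topology \<Rightarrow> ('m, 'n::finite) chart \<Rightarrow> bool" where
  "is_chart X c \<longleftrightarrow>
     openin X (fst c) \<and> open (snd c ` fst c) \<and>
     homeomorphic_map (subtopology X (fst c)) (top_of_set (snd c ` fst c)) (snd c)"

definition chart_inv :: "('m, 'n::finite) chart \<Rightarrow> real ^ 'n \<Rightarrow> 'm" where
  "chart_inv c = inv_into (fst c) (snd c)"

definition transition ::
  "('m, 'n::finite) chart \<Rightarrow> ('m, 'n) chart \<Rightarrow> real ^ 'n \<Rightarrow> real ^ 'n" where
  "transition c c' = snd c' \<circ> chart_inv c"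

definition smooth_manifold :: "'m topology \<Rightarrow> ('m, 'n::finite) chart set \<Rightarrow> bool" where
  "smooth_manifold X A \<longleftrightarrow>
     Hausdorff_space X \<and> second_countable X \<and>
     (\<forall>c\<in>A. is_chart X c) \<and> (\<Union>c\<in>A. fst c) = topspace X \<and>
     (\<forall>c\<in>A. \<forall>c'\<in>A. smooth_on (snd c ` (fst c \<inter> fst c')) (transition c c'))"

section \<open>Tangent bundle and one-forms\<close>

text \<open>A tangent vector at \<open>p\<close> is given by its components \<open>v c\<close> in all the charts \<open>c\<close> of the
  atlas around \<open>p\<close>, related by the Jacobians of the transition maps. For charts not containing
  \<open>p\<close> the value is fixed to be \<open>0\<close>, so that equality of tangent vectors is equality of
  functions.\<close>

type_synonym ('m, 'n) tvec = "('m, 'n) chart \<Rightarrow> real ^ 'n"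

definition jacobian ::
  "('m, 'n::finite) chart \<Rightarrow> ('m, 'n) chart \<Rightarrow> 'm \<Rightarrow> real ^ 'n \<Rightarrow> real ^ 'n" where
  "jacobian c c' p = frechet_derivative (transition c c') (at (snd c p))"

definition charts_at :: "('m, 'n::finite) chart set \<Rightarrow> 'm \<Rightarrow> ('m, 'n) chart set" where
  "charts_at A p = {c \<in> A. p \<in> fst c}"

definition tangent_space :: "('m, 'n::finite) chart set \<Rightarrow> 'm \<Rightarrow> ('m, 'n) tvec set" where
  "tangent_space A p =
     {v. (\<forall>c\<in>charts_at A p. \<forall>c'\<in>charts_at A p. v c' = jacobian c c' p (v c)) \<and>
         (\<forall>c. c \<notin> charts_at A p \<longrightarrow> v c = 0)}"

definition slit_tangent_bundle ::
  "'m topology \<Rightarrow> ('m, 'n::finite) chart set \<Rightarrow> ('m \<times> ('m, 'n) tvec) set" where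
  "slit_tangent_bundle X A =
     {(p, v). p \<in> topspace X \<and> v \<in> tangent_space A p \<and> v \<noteq> (\<lambda>c. 0)}"

text \<open>The point of the tangent bundle with coordinates \<open>(x, y)\<close> in the chart \<open>c\<close>, and the
  coordinates of a point of the tangent bundle.\<close>

definition tb_point ::
  "('m, 'n::finite) chart set \<Rightarrow> ('m, 'n) chart \<Rightarrow> (real ^ 'n) \<times> (real ^ 'n) \<Rightarrow>
     'm \<times> ('m, 'n) tvec" where
  "tb_point A c = (\<lambda>(x, y).
     let p = chart_inv c x in
       (p, \<lambda>c'. if c' \<in> charts_at A p then jacobian c c' p y else 0))"

definition tb_coords ::
  "('m, 'n::finite) chart \<Rightarrow> 'm \<times> ('m, 'n) tvec \<Rightarrow> (real ^ 'n) \<times> (real ^ 'n)" where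
  "tb_coords c = (\<lambda>(p, v). (snd c p, v c))"

definition local_domain ::
  "('m, 'n::finite) chart set \<Rightarrow> ('m, 'n) chart \<Rightarrow> ('m \<times> ('m, 'n) tvec) set \<Rightarrow>
     ((real ^ 'n) \<times> (real ^ 'n)) set" where
  "local_domain A c D = {(x, y). x \<in> snd c ` fst c \<and> tb_point A c (x, y) \<in> D}"

definition local_rep ::
  "('m, 'n::finite) chart set \<Rightarrow> ('m, 'n) chart \<Rightarrow> ('m \<times> ('m, 'n) tvec \<Rightarrow> real) \<Rightarrow>
     (real ^ 'n) \<times> (real ^ 'n) \<Rightarrow> real" where
  "local_rep A c L = (\<lambda>z. L (tb_point A c z))"

text \<open>A smooth one-form, given by its components \<open>b p c $ i\<close>, that is \<open>b\<^sub>i(x)\<close> in the chart \<open>c\<close>;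
  the covariance condition is \<open>b\<^sub>i = b'\<^sub>j \<partial>x'\<^sup>j/\<partial>x\<^sup>i\<close>, evaluated on an arbitrary vector \<open>y\<close>.\<close>

definition smooth_one_form ::
  "'m topology \<Rightarrow> ('m, 'n::finite) chart set \<Rightarrow> ('m \<Rightarrow> ('m, 'n) chart \<Rightarrow> real ^ 'n) \<Rightarrow> bool" where
  "smooth_one_form X A b \<longleftrightarrow>
     (\<forall>p\<in>topspace X. \<forall>c\<in>charts_at A p. \<forall>c'\<in>charts_at A p. \<forall>y.
        b p c \<bullet> y = b p c' \<bullet> jacobian c c' p y) \<and>
     (\<forall>c\<in>A. smooth_on (snd c ` fst c) (\<lambda>x. b (chart_inv c x) c))"

section \<open>Finsler tensors in coordinates\<close>

text \<open>Here \<open>F\<close> is the coordinate expression \<open>L(x, y)\<close> of the Finsler function, \<open>z = (x, y)\<close>, and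
  \<open>\<beta>\<close>-related quantities take the components \<open>b\<close> of the one-form at \<open>x\<close>.\<close>

type_synonym 'n coords = "(real ^ 'n) \<times> (real ^ 'n)"

definition vpartial :: "'n::finite \<Rightarrow> ('n coords \<Rightarrow> real) \<Rightarrow> 'n coords \<Rightarrow> real" where
  "vpartial i f = (\<lambda>(x, y). deriv (\<lambda>s. f (x, y + s *\<^sub>R axis i 1)) 0)"

definition g_low :: "('n::finite coords \<Rightarrow> real) \<Rightarrow> 'n coords \<Rightarrow> 'n \<Rightarrow> 'n \<Rightarrow> real" where
  "g_low F z i j = 1/2 * vpartial i (vpartial j (\<lambda>w. (F w)\<^sup>2)) z"

definition g_mat :: "('n::finite coords \<Rightarrow> real) \<Rightarrow> 'n coords \<Rightarrow> real ^ 'n ^ 'n" where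
  "g_mat F z = (\<chi> i j. g_low F z i j)"

definition g_up :: "('n::finite coords \<Rightarrow> real) \<Rightarrow> 'n coords \<Rightarrow> 'n \<Rightarrow> 'n \<Rightarrow> real" where
  "g_up F z i j = matrix_inv (g_mat F z) $ i $ j"

definition l_low :: "('n::finite coords \<Rightarrow> real) \<Rightarrow> 'n coords \<Rightarrow> 'n \<Rightarrow> real" where
  "l_low F z i = vpartial i F z"

definition y_low :: "('n::finite coords \<Rightarrow> real) \<Rightarrow> 'n coords \<Rightarrow> 'n \<Rightarrow> real" where
  "y_low F z i = (\<Sum>j\<in>UNIV. g_low F z i j * snd z $ j)"

definition h_low :: "('n::finite coords \<Rightarrow> real) \<Rightarrow> 'n coords \<Rightarrow> 'n \<Rightarrow> 'n \<Rightarrow> real" where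
  "h_low F z i j = g_low F z i j - l_low F z i * l_low F z j"

definition cartan :: "('n::finite coords \<Rightarrow> real) \<Rightarrow> 'n coords \<Rightarrow> 'n \<Rightarrow> 'n \<Rightarrow> 'n \<Rightarrow> real" where
  "cartan F z i j k = 1/2 * vpartial k (\<lambda>w. g_low F w i j) z"

definition cartan_vec :: "('n::finite coords \<Rightarrow> real) \<Rightarrow> 'n coords \<Rightarrow> 'n \<Rightarrow> real" where
  "cartan_vec F z i = (\<Sum>j\<in>UNIV. \<Sum>k\<in>UNIV. cartan F z i j k * g_up F z j k)"

definition cartan_sq :: "('n::finite coords \<Rightarrow> real) \<Rightarrow> 'n coords \<Rightarrow> real" where
  "cartan_sq F z = (\<Sum>i\<in>UNIV. \<Sum>j\<in>UNIV. g_up F z i j * cartan_vec F z i * cartan_vec F z j)"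

definition beta :: "real ^ 'n \<Rightarrow> 'n::finite coords \<Rightarrow> real" where
  "beta b z = (\<Sum>i\<in>UNIV. b $ i * snd z $ i)"

definition b_up :: "('n::finite coords \<Rightarrow> real) \<Rightarrow> real ^ 'n \<Rightarrow> 'n coords \<Rightarrow> 'n \<Rightarrow> real" where
  "b_up F b z i = (\<Sum>j\<in>UNIV. g_up F z i j * b $ j)"

definition m_low :: "('n::finite coords \<Rightarrow> real) \<Rightarrow> real ^ 'n \<Rightarrow> 'n coords \<Rightarrow> 'n \<Rightarrow> real" where
  "m_low F b z i = b $ i - beta b z / (F z)\<^sup>2 * y_low F z i"

definition m_sq :: "('n::finite coords \<Rightarrow> real) \<Rightarrow> real ^ 'n \<Rightarrow> 'n coords \<Rightarrow> real" where
  "m_sq F b z = (\<Sum>i\<in>UNIV. \<Sum>j\<in>UNIV. g_up F z i j * m_low F b z i * m_low F b z j)"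

section \<open>Finsler manifolds\<close>

text \<open>The Finsler function lives on an open conic subset \<open>D\<close> of the slit tangent bundle that meets
  every fibre, and the metric tensor is only required to be nondegenerate. The classical case is
  \<open>D = slit_tangent_bundle X A\<close> with positive definite metric tensor.\<close>

definition finsler_manifold ::
  "'m topology \<Rightarrow> ('m, 'n::finite) chart set \<Rightarrow> ('m \<times> ('m, 'n) tvec) set \<Rightarrow>
     ('m \<times> ('m, 'n) tvec \<Rightarrow> real) \<Rightarrow> bool" where
  "finsler_manifold X A D L \<longleftrightarrow>
     smooth_manifold X A \<and>
     D \<subseteq> slit_tangent_bundle X A \<and>
     (\<forall>p\<in>topspace X. \<exists>v. (p, v) \<in> D) \<and>
     (\<forall>c\<in>A. open (local_domain A c D)) \<and>
     (\<forall>(p, v)\<in>D. \<forall>a>0. (p, \<lambda>c. a *\<^sub>R v c) \<in> D \<and> L (p, \<lambda>c. a *\<^sub>R v c) = a * L (p, v)) \<and>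
     (\<forall>u\<in>D. L u > 0) \<and>
     (\<forall>c\<in>A. smooth_on (local_domain A c D) (local_rep A c L)) \<and>
     (\<forall>c\<in>A. \<forall>z\<in>local_domain A c D. invertible (g_mat (local_rep A c L) z))"

text \<open>The following conditions are imposed at the points of a set \<open>W\<close> of the tangent bundle, in
  every chart around each of them.\<close>

definition m_nonzero_on ::
  "('m, 'n::finite) chart set \<Rightarrow> ('m \<times> ('m, 'n) tvec \<Rightarrow> real) \<Rightarrow>
     ('m \<Rightarrow> ('m, 'n) chart \<Rightarrow> real ^ 'n) \<Rightarrow> ('m \<times> ('m, 'n) tvec) set \<Rightarrow> bool" where
  "m_nonzero_on A L b W \<longleftrightarrow>
     (\<forall>u\<in>W. \<forall>c\<in>charts_at A (fst u).
        let F = local_rep A c L; z = tb_coords c u; bx = b (fst u) c in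
          (\<exists>i. m_low F bx z i \<noteq> 0) \<and> m_sq F bx z \<noteq> 0)"

definition b_condition_on ::
  "('m, 'n::finite) chart set \<Rightarrow> ('m \<times> ('m, 'n) tvec \<Rightarrow> real) \<Rightarrow>
     ('m \<Rightarrow> ('m, 'n) chart \<Rightarrow> real ^ 'n) \<Rightarrow> ('m \<times> ('m, 'n) tvec) set \<Rightarrow> bool" where
  "b_condition_on A L b W \<longleftrightarrow>
     (\<forall>u\<in>W. \<forall>c\<in>charts_at A (fst u).
        let F = local_rep A c L; z = tb_coords c u; bx = b (fst u) c in
          \<forall>j k. (\<Sum>i\<in>UNIV. b_up F bx z i * cartan F z i j k) = 0)"

text \<open>Where \<open>C\<^sup>2 = 0\<close>, the term with factor \<open>t/C\<^sup>2\<close> is read as \<open>0\<close> (division by zero); for a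
  positive definite metric tensor this only happens where \<open>C\<^sub>i = 0\<close>.\<close>

definition semi_C_reducible_on ::
  "('m, 'n::finite) chart set \<Rightarrow> ('m \<times> ('m, 'n) tvec \<Rightarrow> real) \<Rightarrow>
     ('m \<times> ('m, 'n) tvec) set \<Rightarrow> bool" where
  "semi_C_reducible_on A L W \<longleftrightarrow>
     (\<exists>r t :: 'm \<times> ('m, 'n) tvec \<Rightarrow> real. \<forall>u\<in>W. r u + t u = 1 \<and>
        (\<forall>c\<in>charts_at A (fst u).
           let F = local_rep A c L; z = tb_coords c u; h = h_low F z; C = cartan_vec F z in
             \<forall>i j k. cartan F z i j k =
               r u / (real CARD('n) + 1) * (h i j * C k + h k i * C j + h j k * C i)
               + t u / cartan_sq F z * C i * C j * C k))"

definition C2_like_on ::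
  "('m, 'n::finite) chart set \<Rightarrow> ('m \<times> ('m, 'n) tvec \<Rightarrow> real) \<Rightarrow>
     ('m \<times> ('m, 'n) tvec) set \<Rightarrow> bool" where
  "C2_like_on A L W \<longleftrightarrow>
     (\<forall>u\<in>W. \<forall>c\<in>charts_at A (fst u).
        let F = local_rep A c L; z = tb_coords c u; C = cartan_vec F z in
          \<forall>i j k. cartan_sq F z * cartan F z i j k = C i * C j * C k)"

definition riemannian_on ::
  "('m, 'n::finite) chart set \<Rightarrow> ('m \<times> ('m, 'n) tvec \<Rightarrow> real) \<Rightarrow>
     ('m \<times> ('m, 'n) tvec) set \<Rightarrow> bool" where
  "riemannian_on A L W \<longleftrightarrow>
     (\<forall>u\<in>W. \<forall>c\<in>charts_at A (fst u).
        \<forall>i j k. cartan (local_rep A c L) (tb_coords c u) i j k = 0)"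

end

theory Submission
  imports Defs
begin

text \<open>The argument is tensor algebra at a single point \<open>(x, y)\<close>. Transvecting the
  semi-C-reducible form of \<open>C\<^sub>i\<^sub>j\<^sub>k\<close> with \<open>b\<^sup>i\<close> kills the left-hand side by the b-condition. It also
  kills every term containing \<open>b\<^sup>iC\<^sub>i\<close>, since \<open>C\<^sub>i\<close> is a trace of \<open>C\<^sub>i\<^sub>j\<^sub>k\<close>. Because \<open>b\<^sup>ih\<^sub>i\<^sub>j = m\<^sub>j\<close>, what
  remains is \<open>r (m\<^sub>jC\<^sub>k + m\<^sub>kC\<^sub>j) = 0\<close>. A symmetrised product of two covectors vanishes only if one of
  them does, and \<open>m \<noteq> 0\<close>, so \<open>r = 0\<close> or all \<open>C\<^sub>k = 0\<close>
  (lemma \<open>semi_C_form_annihilated\<close>).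

  If \<open>r = 0\<close>, then \<open>t = 1\<close> and the semi-C-reducible form is the \<open>C\<^sub>2\<close>-like one. If \<open>C\<^sub>k = 0\<close>, the
  form gives \<open>C\<^sub>i\<^sub>j\<^sub>k = 0\<close>. Which case occurs may depend on the point, but where \<open>C\<^sub>i\<^sub>j\<^sub>k = 0\<close> both sides
  of the \<open>C\<^sub>2\<close>-like identity vanish, so that identity holds at every point
  (lemma \<open>C2_like_at\<close>) and the points need not be treated separately.

  The identity \<open>b\<^sup>ih\<^sub>i\<^sub>j = m\<^sub>j\<close> (lemma \<open>h_low_b_up\<close>) is where the Finsler structure enters. Raising and
  lowering an index are inverse operations, and \<open>b\<^sup>il\<^sub>i = \<beta>/L\<close>, because \<open>y\<^sub>i = L l\<^sub>i\<close>. This rests on two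
  facts about \<open>L\<close> in coordinates: Euler's relation with its derivative
  \<open>y\<^sup>j \<partial>\<^sup>2L/\<partial>y\<^sup>i\<partial>y\<^sup>j = 0\<close>, and the symmetry of \<open>\<partial>\<^sup>2L/\<partial>y\<^sup>i\<partial>y\<^sup>j\<close> (lemma \<open>mixed_derivatives_eq\<close>).\<close>

section \<open>Symmetry of second directional derivatives\<close>

lemma DERIV_along_line:
  fixes f :: "'a::real_normed_vector \<Rightarrow> real"
  assumes "((\<lambda>s. f ((w + a *\<^sub>R u) + s *\<^sub>R u)) has_real_derivative d) (at 0)"
  shows "((\<lambda>s. f (w + s *\<^sub>R u)) has_real_derivative d) (at a)"
proof -
  have "((\<lambda>s. f (w + (s + a) *\<^sub>R u)) has_real_derivative d) (at 0)"
    using assms by (simp add: algebra_simps)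
  then show ?thesis
    using DERIV_shift[of "\<lambda>s. f (w + s *\<^sub>R u)" d 0 a] by simp
qed

text \<open>The mean value theorem is applied twice: first along \<open>u\<close> to the increment of \<open>f\<close> in the direction
  \<open>v\<close>, then along \<open>v\<close> to the derivative \<open>fu\<close>.\<close>

lemma second_difference_eq_second_derivative:
  fixes f fu fuv :: "'a::real_normed_vector \<Rightarrow> real"
  assumes "h > 0" and ball: "cball z (h * (norm u + norm v)) \<subseteq> S"
    and fu: "\<And>w. w \<in> S \<Longrightarrow> ((\<lambda>s. f (w + s *\<^sub>R u)) has_real_derivative fu w) (at 0)"
    and fuv: "\<And>w. w \<in> S \<Longrightarrow> ((\<lambda>s. fu (w + s *\<^sub>R v)) has_real_derivative fuv w) (at 0)"
  shows "\<exists>w \<in> cball z (h * (norm u + norm v)).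
    f (z + h *\<^sub>R u + h *\<^sub>R v) - f (z + h *\<^sub>R u) - f (z + h *\<^sub>R v) + f z = h * h * fuv w"
proof -
  have near: "z + a *\<^sub>R u + c *\<^sub>R v \<in> cball z (h * (norm u + norm v))"
    if "0 \<le> a" "a \<le> h" "0 \<le> c" "c \<le> h" for a c
  proof -
    have "norm (a *\<^sub>R u + c *\<^sub>R v) \<le> a * norm u + c * norm v"
      using that norm_triangle_ineq[of "a *\<^sub>R u" "c *\<^sub>R v"] by simp
    also have "\<dots> \<le> h * norm u + h * norm v"
      using that by (intro add_mono mult_right_mono) auto
    finally show ?thesis
      by (simp add: dist_norm norm_minus_commute algebra_simps)
  qed
  define p where "p s = f (z + h *\<^sub>R v + s *\<^sub>R u) - f (z + s *\<^sub>R u)" for s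
  have dp: "(p has_real_derivative (fu (z + s *\<^sub>R u + h *\<^sub>R v) - fu (z + s *\<^sub>R u))) (at s)"
    if "0 \<le> s" "s \<le> h" for s
  proof -
    have "z + h *\<^sub>R v + s *\<^sub>R u \<in> S" "z + s *\<^sub>R u \<in> S"
      using near[of s h] near[of s 0] that \<open>h > 0\<close> ball by (auto simp: algebra_simps)
    then have "(p has_real_derivative (fu (z + h *\<^sub>R v + s *\<^sub>R u) - fu (z + s *\<^sub>R u))) (at s)"
      unfolding p_def by (intro DERIV_diff DERIV_along_line[OF fu])
    then show ?thesis by (simp add: algebra_simps)
  qed
  obtain a where a: "0 < a" "a < h"
    "p h - p 0 = (h - 0) * (fu (z + a *\<^sub>R u + h *\<^sub>R v) - fu (z + a *\<^sub>R u))"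
    using MVT2[OF \<open>h > 0\<close> dp] by blast
  define q where "q t = fu (z + a *\<^sub>R u + t *\<^sub>R v)" for t
  have dq: "(q has_real_derivative fuv (z + a *\<^sub>R u + t *\<^sub>R v)) (at t)"
    if "0 \<le> t" "t \<le> h" for t
    unfolding q_def
    using near[of a t] that a ball by (intro DERIV_along_line[OF fuv]) auto
  obtain t where t: "0 < t" "t < h"
    "q h - q 0 = (h - 0) * fuv (z + a *\<^sub>R u + t *\<^sub>R v)"
    using MVT2[OF \<open>h > 0\<close> dq] by blast
  have "f (z + h *\<^sub>R u + h *\<^sub>R v) - f (z + h *\<^sub>R u) - f (z + h *\<^sub>R v) + f z
      = h * h * fuv (z + a *\<^sub>R u + t *\<^sub>R v)"
    using a(3) t(3) by (simp add: p_def q_def algebra_simps)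
  moreover have "z + a *\<^sub>R u + t *\<^sub>R v \<in> cball z (h * (norm u + norm v))"
    using a t by (intro near) auto
  ultimately show ?thesis by blast
qed

text \<open>The second difference is symmetric in \<open>u\<close> and \<open>v\<close>, so by the previous lemma \<open>fuv\<close> and \<open>fvu\<close> take
  equal values at suitable points arbitrarily close to \<open>z\<close>; continuity carries this to \<open>z\<close>.\<close>

lemma mixed_derivatives_eq:
  fixes f fu fv fuv fvu :: "'a::real_normed_vector \<Rightarrow> real"
  assumes "open S" "z \<in> S"
    and fu: "\<And>w. w \<in> S \<Longrightarrow> ((\<lambda>s. f (w + s *\<^sub>R u)) has_real_derivative fu w) (at 0)"
    and fv: "\<And>w. w \<in> S \<Longrightarrow> ((\<lambda>s. f (w + s *\<^sub>R v)) has_real_derivative fv w) (at 0)"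
    and fuv: "\<And>w. w \<in> S \<Longrightarrow> ((\<lambda>s. fu (w + s *\<^sub>R v)) has_real_derivative fuv w) (at 0)"
    and fvu: "\<And>w. w \<in> S \<Longrightarrow> ((\<lambda>s. fv (w + s *\<^sub>R u)) has_real_derivative fvu w) (at 0)"
    and cont: "continuous_on S fuv" "continuous_on S fvu"
  shows "fuv z = fvu z"
proof (rule ccontr)
  assume "fuv z \<noteq> fvu z"
  define e where "e = \<bar>fuv z - fvu z\<bar> / 2"
  have "e > 0" using \<open>fuv z \<noteq> fvu z\<close> by (simp add: e_def)
  have "isCont fuv z" "isCont fvu z"
    using cont assms(1,2) by (auto simp: continuous_on_eq_continuous_at)
  then obtain d1 d2 where d: "d1 > 0" "d2 > 0"
    "\<And>w. dist w z < d1 \<Longrightarrow> dist (fuv w) (fuv z) < e"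
    "\<And>w. dist w z < d2 \<Longrightarrow> dist (fvu w) (fvu z) < e"
    using \<open>e > 0\<close> unfolding continuous_at_eps_delta by metis
  obtain d3 where d3: "d3 > 0" "ball z d3 \<subseteq> S"
    using assms(1,2) openE by blast
  define d where "d = min d1 (min d2 d3)"
  \<comment> \<open>The extra \<open>1\<close> keeps the denominator positive when \<open>u = v = 0\<close>, and makes the closed ball
    containing the parallelogram fit strictly inside the open ball of radius \<open>d\<close>.\<close>
  define h where "h = d / (norm u + norm v + 1)"
  have pos: "norm u + norm v + 1 > 0" by (smt (verit) norm_ge_zero)
  have "d > 0" using d d3 by (simp add: d_def)
  then have "h > 0" using pos by (simp add: h_def)
  have "h * (norm u + norm v + 1) = d" using pos by (simp add: h_def)
  then have small: "h * (norm u + norm v) < d" using \<open>h > 0\<close> by (simp add: distrib_left)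
  then have ball: "cball z (h * (norm u + norm v)) \<subseteq> S"
    using d3 by (auto simp: d_def subset_eq)
  have ball': "cball z (h * (norm v + norm u)) \<subseteq> S"
    using ball by (simp add: add.commute)
  obtain w where w: "w \<in> cball z (h * (norm u + norm v))"
    "f (z + h *\<^sub>R u + h *\<^sub>R v) - f (z + h *\<^sub>R u) - f (z + h *\<^sub>R v) + f z = h * h * fuv w"
    using second_difference_eq_second_derivative[OF \<open>h > 0\<close> ball fu fuv] by blast
  obtain w' where w': "w' \<in> cball z (h * (norm v + norm u))"
    "f (z + h *\<^sub>R v + h *\<^sub>R u) - f (z + h *\<^sub>R v) - f (z + h *\<^sub>R u) + f z = h * h * fvu w'"
    using second_difference_eq_second_derivative[OF \<open>h > 0\<close> ball' fv fvu] by blast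
  have "h * h * fuv w = h * h * fvu w'"
    using w(2) w'(2) by (simp add: algebra_simps)
  then have "fuv w = fvu w'" using \<open>h > 0\<close> by simp
  moreover have "dist (fuv w) (fuv z) < e"
    using w(1) small by (intro d) (simp add: d_def dist_commute)
  moreover have "dist (fvu w') (fvu z) < e"
    using w'(1) small by (intro d) (simp add: d_def dist_commute add.commute)
  ultimately have "dist (fuv z) (fvu z) < e + e"
    using dist_triangle_less_add[of "fuv z" "fuv w" e "fvu z" e] by (simp add: dist_commute)
  then show False by (simp add: e_def dist_real_def)
qed

section \<open>Vertical partial derivatives\<close>

text \<open>Vertical partials are directional derivatives along the basis vectors \<open>(0, axis i 1)\<close>. The first
  form serves the one-variable differentiation rules, the second relates vertical partials to the
  total derivative.\<close>

lemma vpartial_has_derivative: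
  fixes f :: "'n::finite coords \<Rightarrow> real"
  assumes "f differentiable (at z)"
  shows "((\<lambda>s. f (z + s *\<^sub>R (0, axis i 1))) has_real_derivative vpartial i f z) (at 0)"
    and "vpartial i f z = frechet_derivative f (at z) (0, axis i 1)"
proof -
  let ?D = "frechet_derivative f (at z)"
  have D: "(f has_derivative ?D) (at (z + 0 *\<^sub>R (0, axis i 1)))"
    using assms by (simp add: frechet_derivative_works flip: zero_prod_def)
  have "((\<lambda>s::real. z + s *\<^sub>R (0, axis i 1)) has_derivative (\<lambda>s. s *\<^sub>R (0, axis i 1))) (at 0)"
    by (auto intro!: derivative_eq_intros)
  from has_derivative_compose[OF this D]
  have "((\<lambda>s. f (z + s *\<^sub>R (0, axis i 1))) has_derivative (\<lambda>s. ?D (s *\<^sub>R (0, axis i 1)))) (at 0)" .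
  moreover have "(\<lambda>s. ?D (s *\<^sub>R (0, axis i 1))) = (*) (?D (0, axis i 1))"
    by (simp add: linear_scale[OF linear_frechet_derivative[OF assms]] fun_eq_iff
        del: scaleR_Pair)
  ultimately have *:
    "((\<lambda>s. f (z + s *\<^sub>R (0, axis i 1))) has_real_derivative ?D (0, axis i 1)) (at 0)"
    by (simp add: has_field_derivative_def)
  show eq: "vpartial i f z = ?D (0, axis i 1)"
    using DERIV_imp_deriv[OF *] by (simp add: vpartial_def case_prod_beta plus_prod_def)
  show "((\<lambda>s. f (z + s *\<^sub>R (0, axis i 1))) has_real_derivative vpartial i f z) (at 0)"
    using * unfolding eq .
qed

lemma vpartial_eqI:
  fixes f :: "'n::finite coords \<Rightarrow> real"
  assumes "((\<lambda>s. f (z + s *\<^sub>R (0, axis i 1))) has_real_derivative d) (at 0)"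
  shows "vpartial i f z = d"
  using DERIV_imp_deriv[OF assms] by (simp add: vpartial_def case_prod_beta plus_prod_def)

lemma has_vpartial_cong_open:
  fixes f g :: "'n::finite coords \<Rightarrow> real"
  assumes "open S" "z \<in> S" and eq: "\<And>w. w \<in> S \<Longrightarrow> f w = g w"
    and "((\<lambda>s. f (z + s *\<^sub>R (0, axis i 1))) has_real_derivative d) (at 0)"
  shows "((\<lambda>s. g (z + s *\<^sub>R (0, axis i 1))) has_real_derivative d) (at 0)"
proof -
  let ?p = "\<lambda>s::real. z + s *\<^sub>R (0, axis i 1)"
  have "open (?p -` S)"
    using assms(1) by (intro open_vimage continuous_intros)
  from has_field_derivative_transform_within_open[OF assms(4) this]
  show ?thesis using \<open>z \<in> S\<close> eq by (simp flip: zero_prod_def)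
qed

text \<open>Smoothness is phrased with total derivatives on all basis vectors of the product space; these are
  the consequences for vertical partials. On the open set \<open>S\<close> the two kinds of derivative agree,
  which lets them be exchanged under a further differentiation.\<close>

lemma smooth_on_C2_vertical:
  fixes F :: "'n::finite coords \<Rightarrow> real"
  assumes "open S" "smooth_on S F"
  shows "z \<in> S \<Longrightarrow> F differentiable (at z)"
    and "z \<in> S \<Longrightarrow> vpartial i F differentiable (at z)"
    and "continuous_on S (vpartial j (vpartial i F))"
proof -
  let ?e = "\<lambda>i. (0, axis i 1) :: 'n coords"
  have B: "?e i \<in> Basis" for i
    by (auto simp: Basis_prod_def axis_in_Basis_iff)
  have "Ck_on (Suc (Suc 0)) S F" using assms(2) unfolding smooth_on_def by blast
  then have F: "\<And>z. z \<in> S \<Longrightarrow> F differentiable (at z)"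
    and F': "\<And>z i. z \<in> S \<Longrightarrow> (\<lambda>w. frechet_derivative F (at w) (?e i)) differentiable (at z)"
    and F'': "\<And>i j. continuous_on S (\<lambda>w. frechet_derivative
                (\<lambda>w. frechet_derivative F (at w) (?e i)) (at w) (?e j))"
    using B by auto
  show "z \<in> S \<Longrightarrow> F differentiable (at z)" by (rule F)
  have eq: "vpartial i F w = frechet_derivative F (at w) (?e i)" if "w \<in> S" for w i
    using vpartial_has_derivative(2)[OF F[OF that]] .
  have D: "(vpartial i F has_derivative
       frechet_derivative (\<lambda>w. frechet_derivative F (at w) (?e i)) (at w)) (at w)"
    if "w \<in> S" for w i
  proof (rule has_derivative_transform_within_open[OF _ \<open>open S\<close> that])
    show "((\<lambda>w. frechet_derivative F (at w) (?e i)) has_derivative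
       frechet_derivative (\<lambda>w. frechet_derivative F (at w) (?e i)) (at w)) (at w)"
      using F'[OF that] by (simp add: frechet_derivative_works)
  qed (simp add: eq)
  show dv: "z \<in> S \<Longrightarrow> vpartial i F differentiable (at z)" for z i
    using D differentiable_def by blast
  have "vpartial j (vpartial i F) w =
      frechet_derivative (\<lambda>w. frechet_derivative F (at w) (?e i)) (at w) (?e j)"
    if "w \<in> S" for w
    using vpartial_has_derivative(2)[OF dv[OF that], of j] frechet_derivative_at[OF D[OF that]]
    by metis
  then show "continuous_on S (vpartial j (vpartial i F))"
    using F''[of i j] continuous_on_cong[of S S] by (metis (no_types, lifting))
qed

section \<open>Finsler functions in coordinates\<close>

locale coordinate_finsler =
  fixes S :: "('n::finite coords) set" and F :: "'n coords \<Rightarrow> real"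
  assumes open_dom: "open S"
    and smooth: "smooth_on S F"
    and homogeneous: "\<And>x y a. (x, y) \<in> S \<Longrightarrow> a > 0 \<Longrightarrow> F (x, a *\<^sub>R y) = a * F (x, y)"
    and positive: "\<And>z. z \<in> S \<Longrightarrow> F z > 0"
    and nondegenerate: "\<And>z. z \<in> S \<Longrightarrow> invertible (g_mat F z)"
begin

lemmas differentiable = smooth_on_C2_vertical(1)[OF open_dom smooth]
  and vpartial_differentiable = smooth_on_C2_vertical(2)[OF open_dom smooth]
  and continuous_second_vpartial = smooth_on_C2_vertical(3)[OF open_dom smooth]

lemmas deriv_F = vpartial_has_derivative(1)[OF differentiable]
  and deriv_vpartial_F = vpartial_has_derivative(1)[OF vpartial_differentiable]

lemma vpartial_commute:
  assumes "z \<in> S"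
  shows "vpartial i (vpartial j F) z = vpartial j (vpartial i F) z"
  by (rule mixed_derivatives_eq[where f = F and u = "(0, axis j 1)" and v = "(0, axis i 1)"
        and fu = "vpartial j F" and fv = "vpartial i F"])
    (fact open_dom assms continuous_second_vpartial deriv_F deriv_vpartial_F)+

text \<open>Euler's theorem for degree one: both \<open>a \<mapsto> F (x, a y)\<close> and \<open>a \<mapsto> a F (x, y)\<close> are
  differentiated at \<open>a = 1\<close>.\<close>

lemma euler_relation:
  assumes "z \<in> S"
  shows "(\<Sum>j\<in>UNIV. snd z $ j * vpartial j F z) = F z"
proof -
  obtain x y where z: "z = (x, y)" by (cases z)
  let ?D = "frechet_derivative F (at z)"
  have D: "(F has_derivative ?D) (at (x, 1 *\<^sub>R y))"
    using differentiable[OF assms] by (simp add: frechet_derivative_works z)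
  have lin: "linear ?D"
    using linear_frechet_derivative differentiable[OF assms] by blast
  have "((\<lambda>a::real. (x, a *\<^sub>R y)) has_derivative (\<lambda>a. (0, a *\<^sub>R y))) (at 1)"
    by (auto intro!: derivative_eq_intros)
  from has_derivative_compose[OF this D]
  have 1: "((\<lambda>a. F (x, a *\<^sub>R y)) has_derivative (\<lambda>a. ?D (0, a *\<^sub>R y))) (at 1)" .
  have 2: "((\<lambda>a. F (x, a *\<^sub>R y)) has_derivative (\<lambda>a. a * F z)) (at 1)"
  proof (rule has_derivative_transform_within_open[where s = "{0<..}"])
    show "((\<lambda>a. a * F z) has_derivative (\<lambda>a. a * F z)) (at 1)"
      by (auto intro!: derivative_eq_intros)
  qed (use homogeneous assms z in auto)
  have "(\<lambda>a. ?D (0, a *\<^sub>R y)) = (\<lambda>a. a * F z)"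
    by (rule has_derivative_unique[OF 1 2])
  from fun_cong[OF this, of 1] have "?D (0, y) = F z" by simp
  moreover have "(0, y) = (\<Sum>j\<in>UNIV. y $ j *\<^sub>R ((0, axis j 1) :: 'n coords))"
    by (simp add: prod_eq_iff fst_sum snd_sum basis_expansion flip: scalar_mult_eq_scaleR)
  ultimately have "F z = (\<Sum>j\<in>UNIV. y $ j * ?D (0, axis j 1))"
    by (simp add: linear_sum[OF lin] linear_scale[OF lin] del: scaleR_Pair)
  then show ?thesis
    using vpartial_has_derivative(2)[OF differentiable[OF assms]] by (simp add: z)
qed

text \<open>Differentiating Euler's relation in the direction \<open>i\<close> produces the term \<open>\<partial>F/\<partial>y\<^sup>i\<close> on both sides;
  after cancelling, only the Hessian term is left.\<close>

lemma hessian_radial: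
  assumes "z \<in> S"
  shows "(\<Sum>j\<in>UNIV. vpartial i (vpartial j F) z * snd z $ j) = 0"
proof -
  let ?e = "(0, axis i 1) :: 'n coords"
  have y: "((\<lambda>s. snd (z + s *\<^sub>R ?e) $ j) has_real_derivative axis i 1 $ j) (at 0)" for j
    by (auto intro!: derivative_eq_intros)
  have "((\<lambda>s. \<Sum>j\<in>UNIV. snd (z + s *\<^sub>R ?e) $ j * vpartial j F (z + s *\<^sub>R ?e))
      has_real_derivative (\<Sum>j\<in>UNIV. axis i 1 $ j * vpartial j F z +
         vpartial i (vpartial j F) z * snd z $ j)) (at 0)"
    using DERIV_mult[OF y deriv_vpartial_F[OF assms]] by (intro DERIV_sum) (simp flip: zero_prod_def)
  from has_vpartial_cong_open[where f = "\<lambda>w. \<Sum>j\<in>UNIV. snd w $ j * vpartial j F w",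
      OF open_dom assms euler_relation this]
  have "vpartial i F z = (\<Sum>j\<in>UNIV. axis i 1 $ j * vpartial j F z +
         vpartial i (vpartial j F) z * snd z $ j)"
    by (intro vpartial_eqI) auto
  then show ?thesis
    by (simp add: sum.distrib axis_def if_distrib[of "\<lambda>c. c * _"] cong: if_cong)
qed

text \<open>The product rule for \<open>F\<^sup>2/2\<close>. It reduces the symmetry of \<open>g\<close> to that of the Hessian of \<open>F\<close>, and
  shows that the angular metric \<open>h\<close> is \<open>F\<close> times that Hessian.\<close>

lemma g_low_eq:
  assumes "z \<in> S"
  shows "g_low F z i j = vpartial i F z * vpartial j F z + F z * vpartial i (vpartial j F) z"
proof -
  have sq: "vpartial j (\<lambda>w. (F w)\<^sup>2) w = 2 * F w * vpartial j F w" if "w \<in> S" for w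
    using DERIV_power[OF deriv_F[OF that], where n = 2]
    by (intro vpartial_eqI) (simp add: ac_simps flip: zero_prod_def)
  have "((\<lambda>s. 2 * F (z + s *\<^sub>R (0, axis i 1)) * vpartial j F (z + s *\<^sub>R (0, axis i 1)))
      has_real_derivative 2 * vpartial i F z * vpartial j F z
        + vpartial i (vpartial j F) z * (2 * F z)) (at 0)"
    using DERIV_mult[OF DERIV_cmult[OF deriv_F[OF assms], where c = 2] deriv_vpartial_F[OF assms]]
    by (simp flip: zero_prod_def)
  from has_vpartial_cong_open[where f = "\<lambda>w. 2 * F w * vpartial j F w",
      OF open_dom assms sq[symmetric] this]
  have "vpartial i (vpartial j (\<lambda>w. (F w)\<^sup>2)) z =
      2 * vpartial i F z * vpartial j F z + vpartial i (vpartial j F) z * (2 * F z)"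
    by (intro vpartial_eqI)
  then show ?thesis by (simp add: g_low_def)
qed

lemma g_low_commute: "z \<in> S \<Longrightarrow> g_low F z i j = g_low F z j i"
  by (simp add: g_low_eq vpartial_commute[of z i j])

lemma h_low_commute: "z \<in> S \<Longrightarrow> h_low F z i j = h_low F z j i"
  by (simp add: h_low_def g_low_commute[of z i j])

lemma y_low_eq:
  assumes "z \<in> S"
  shows "y_low F z i = F z * l_low F z i"
proof -
  have "y_low F z i = l_low F z i * (\<Sum>j\<in>UNIV. snd z $ j * vpartial j F z) +
      F z * (\<Sum>j\<in>UNIV. vpartial i (vpartial j F) z * snd z $ j)"
    by (simp add: y_low_def g_low_eq[OF assms] l_low_def sum_distrib_left sum.distrib algebra_simps)
  then show ?thesis by (simp add: euler_relation[OF assms] hessian_radial[OF assms])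
qed

lemma lower_b_up:
  assumes "z \<in> S"
  shows "(\<Sum>j\<in>UNIV. g_low F z i j * b_up F b z j) = b $ i"
proof -
  let ?G = "g_mat F z"
  have inv: "?G ** matrix_inv ?G = mat 1"
    using nondegenerate[OF assms] unfolding invertible_def matrix_inv_def
    by (rule someI2_ex) simp
  have up: "b_up F b z j = (matrix_inv ?G *v b) $ j" for j
    by (simp add: b_up_def g_up_def matrix_vector_mult_def)
  have "(\<Sum>j\<in>UNIV. g_low F z i j * b_up F b z j) = (?G *v (matrix_inv ?G *v b)) $ i"
    unfolding up by (subst (2) matrix_vector_mult_def) (simp add: g_mat_def)
  also have "\<dots> = b $ i"
    by (simp add: matrix_vector_mul_assoc inv)
  finally show ?thesis .
qed

text \<open>Since \<open>h\<^sub>i\<^sub>j = g\<^sub>i\<^sub>j - l\<^sub>il\<^sub>j\<close>, transvection with \<open>b\<^sup>i\<close> gives \<open>b\<^sub>j - (b\<^sup>il\<^sub>i) l\<^sub>j\<close>. Here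
  \<open>F b\<^sup>il\<^sub>i = b\<^sup>iy\<^sub>i = b\<^sub>ky\<^sup>k = \<beta>\<close> and \<open>l\<^sub>j = y\<^sub>j/F\<close>, which is the definition of \<open>m\<^sub>j\<close>. In other words,
  \<open>m\<close> is the part of \<open>b\<close> that is orthogonal to the direction \<open>y\<close>.\<close>

lemma h_low_b_up:
  assumes "z \<in> S"
  shows "(\<Sum>i\<in>UNIV. b_up F b z i * h_low F z i j) = m_low F b z j"
proof -
  let ?B = "b_up F b z" and ?l = "l_low F z"
  have "F z * (\<Sum>i\<in>UNIV. ?B i * ?l i) = (\<Sum>i\<in>UNIV. ?B i * y_low F z i)"
    by (simp add: y_low_eq[OF assms] sum_distrib_left algebra_simps)
  also have "\<dots> = (\<Sum>i\<in>UNIV. \<Sum>k\<in>UNIV. snd z $ k * (g_low F z k i * ?B i))"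
    by (simp add: y_low_def sum_distrib_left g_low_commute[OF assms] algebra_simps)
  also have "\<dots> = (\<Sum>k\<in>UNIV. snd z $ k * (\<Sum>i\<in>UNIV. g_low F z k i * ?B i))"
    by (subst sum.swap) (simp add: sum_distrib_left)
  also have "\<dots> = beta b z"
    unfolding lower_b_up[OF assms] beta_def by (simp add: mult.commute)
  finally have l: "(\<Sum>i\<in>UNIV. ?B i * ?l i) = beta b z / F z"
    using positive[OF assms] by (simp add: field_simps)
  have "(\<Sum>i\<in>UNIV. ?B i * h_low F z i j) =
      (\<Sum>i\<in>UNIV. g_low F z j i * ?B i) - (\<Sum>i\<in>UNIV. ?B i * ?l i) * ?l j"
    unfolding sum_distrib_right sum_subtractf[symmetric]
    by (simp add: h_low_def g_low_commute[OF assms, of _ j] algebra_simps)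
  also have "\<dots> = b $ j - beta b z / F z * ?l j"
    by (simp add: l lower_b_up[OF assms])
  also have "\<dots> = m_low F b z j"
    using positive[OF assms]
    by (simp add: m_low_def y_low_eq[OF assms] power2_eq_square)
  finally show ?thesis .
qed

end

section \<open>Contraction of the semi-C-reducible form\<close>

text \<open>The contraction with \<open>B\<close> leaves \<open>\<rho> (m\<^sub>jC\<^sub>k + m\<^sub>kC\<^sub>j) = 0\<close> with \<open>m\<^sub>j = B\<^sup>ih\<^sub>i\<^sub>j\<close>. If \<open>\<rho> \<noteq> 0\<close>, taking
  \<open>j = k = p\<close> with \<open>m\<^sub>p \<noteq> 0\<close> gives \<open>C\<^sub>p = 0\<close>, and then \<open>j = p\<close> gives \<open>C\<^sub>k = 0\<close> for all \<open>k\<close>.\<close>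

lemma semi_C_form_annihilated:
  fixes T :: "'n::finite \<Rightarrow> 'n \<Rightarrow> 'n \<Rightarrow> real" and h :: "'n \<Rightarrow> 'n \<Rightarrow> real"
  assumes T: "\<And>i j k. T i j k =
      \<rho> * (h i j * C k + h k i * C j + h j k * C i) + \<tau> * C i * C j * C k"
    and sym: "\<And>i j. h i j = h j i"
    and BT: "\<And>j k. (\<Sum>i\<in>UNIV. B i * T i j k) = 0"
    and BC: "(\<Sum>i\<in>UNIV. B i * C i) = 0"
    and m: "(\<Sum>i\<in>UNIV. B i * h i p) \<noteq> 0"
  shows "\<rho> = 0 \<or> (\<forall>k. C k = 0)"
proof -
  define m where "m j = (\<Sum>i\<in>UNIV. B i * h i j)" for j
  have eq: "\<rho> * (m j * C k + m k * C j) = 0" for j k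
  proof -
    have "0 = (\<Sum>i\<in>UNIV. B i * T i j k)" by (simp add: BT)
    also have "\<dots> = \<rho> * (m j * C k + m k * C j)
        + (\<rho> * h j k + \<tau> * C j * C k) * (\<Sum>i\<in>UNIV. B i * C i)"
      unfolding T m_def sym[of k]
      by (simp add: sum_distrib_left sum_distrib_right flip: sum.distrib)
        (simp add: algebra_simps)
    finally show ?thesis by (simp add: BC)
  qed
  have "C k = 0" if "\<rho> \<noteq> 0" for k
  proof -
    have mp: "m p \<noteq> 0" using m by (simp add: m_def)
    then have "C p = 0" using eq[of p p] that by simp
    then show ?thesis using eq[of p k] that mp by simp
  qed
  then show ?thesis by blast
qed

text \<open>Where \<open>C\<^sup>2 \<noteq> 0\<close> and \<open>r = 0\<close>, the identity is the semi-C-reducible form multiplied by \<open>C\<^sup>2\<close>. In the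
  other cases the form collapses to \<open>C\<^sub>i\<^sub>j\<^sub>k = 0\<close>, and both sides vanish.\<close>

lemma (in coordinate_finsler) C2_like_at:
  assumes z: "z \<in> S"
    and semi: "\<And>i j k. cartan F z i j k =
        r / (real CARD('n) + 1) * (h_low F z i j * cartan_vec F z k
          + h_low F z k i * cartan_vec F z j + h_low F z j k * cartan_vec F z i)
        + t / cartan_sq F z * cartan_vec F z i * cartan_vec F z j * cartan_vec F z k"
    and "r + t = 1"
    and bC: "\<And>j k. (\<Sum>i\<in>UNIV. b_up F b z i * cartan F z i j k) = 0"
    and m: "m_low F b z p \<noteq> 0"
  shows "cartan_sq F z * cartan F z i j k = cartan_vec F z i * cartan_vec F z j * cartan_vec F z k"
proof -
  let ?C = "cartan_vec F z"
  have "(\<Sum>i\<in>UNIV. b_up F b z i * ?C i) =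
      (\<Sum>i\<in>UNIV. \<Sum>j\<in>UNIV. \<Sum>k\<in>UNIV. g_up F z j k * (b_up F b z i * cartan F z i j k))"
    by (simp add: cartan_vec_def sum_distrib_left algebra_simps)
  also have "\<dots> =
      (\<Sum>j\<in>UNIV. \<Sum>i\<in>UNIV. \<Sum>k\<in>UNIV. g_up F z j k * (b_up F b z i * cartan F z i j k))"
    by (rule sum.swap)
  also have "\<dots> =
      (\<Sum>j\<in>UNIV. \<Sum>k\<in>UNIV. \<Sum>i\<in>UNIV. g_up F z j k * (b_up F b z i * cartan F z i j k))"
    by (intro sum.cong refl sum.swap)
  also have "\<dots> = 0"
    by (simp add: bC flip: sum_distrib_left)
  finally have BC: "(\<Sum>i\<in>UNIV. b_up F b z i * ?C i) = 0" .
  have "r / (real CARD('n) + 1) = 0 \<or> (\<forall>k. ?C k = 0)"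
    by (rule semi_C_form_annihilated[OF semi h_low_commute[OF z] bC BC])
      (use m in \<open>simp add: h_low_b_up[OF z]\<close>)
  moreover have "real CARD('n) + 1 \<noteq> 0" by (simp add: add_nonneg_eq_0_iff)
  ultimately consider "r = 0" | "\<And>k. ?C k = 0" by auto
  then show ?thesis
  proof cases
    case 1
    show ?thesis
    \<comment> \<open>For \<open>C\<^sup>2 = 0\<close> the quotient \<open>t/C\<^sup>2\<close> has the default value \<open>0\<close>, so the whole form vanishes.\<close>
    proof (cases "cartan_sq F z = 0")
      case True
      then have "cartan F z i j k = 0" for i j k
        using semi[of i j k] 1 by simp
      then show ?thesis by (simp add: cartan_vec_def)
    next
      case False
      then show ?thesis
        using semi[of i j k] 1 \<open>r + t = 1\<close> by simp
    qed
  next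
    case 2
    then show ?thesis using semi[of i j k] by simp
  qed
qed

section \<open>From the manifold to coordinates\<close>

lemma chart_inv_coords:
  assumes "is_chart X c" "p \<in> fst c"
  shows "chart_inv c (snd c p) = p"
proof -
  have "fst c \<subseteq> topspace X"
    using assms(1) openin_subset unfolding is_chart_def by blast
  then have "inj_on (snd c) (fst c)"
    using assms(1) homeomorphic_imp_injective_map
    unfolding is_chart_def by (metis topspace_subtopology_subset)
  then show ?thesis
    using assms(2) by (simp add: chart_inv_def inv_into_f_f)
qed

text \<open>A vector of the tangent space is determined by its components in one chart, as these are transformed
  by the Jacobians into its components in the other charts.\<close>

lemma tb_point_tb_coords:
  assumes "is_chart X c" "c \<in> charts_at A p" "v \<in> tangent_space A p"
  shows "tb_point A c (tb_coords c (p, v)) = (p, v)"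
proof -
  have "chart_inv c (snd c p) = p"
    using assms(2) chart_inv_coords[OF assms(1)] by (simp add: charts_at_def)
  moreover have "(\<lambda>c'. if c' \<in> charts_at A p then jacobian c c' p (v c) else 0) = v"
  proof
    fix c'
    have "v c' = jacobian c c' p (v c)" if "c' \<in> charts_at A p"
      using assms(2,3) that unfolding tangent_space_def by blast
    moreover have "v c' = 0" if "c' \<notin> charts_at A p"
      using assms(3) that unfolding tangent_space_def by blast
    ultimately show "(if c' \<in> charts_at A p then jacobian c c' p (v c) else 0) = v c'"
      by presburger
  qed
  ultimately show ?thesis
    by (simp add: tb_point_def tb_coords_def)
qed

text \<open>The fibre coordinates depend linearly on the tangent vector because the Jacobians of the smooth
  transition maps are linear; this turns homogeneity of \<open>L\<close> on the fibres into homogeneity of its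
  coordinate expression.\<close>

lemma tb_point_scaleR:
  assumes "smooth_manifold X A" "c \<in> A" "x \<in> snd c ` fst c"
    and "tb_point A c (x, y) = (p, v)"
  shows "tb_point A c (x, a *\<^sub>R y) = (p, \<lambda>c. a *\<^sub>R v c)"
proof -
  have p: "p = chart_inv c x" and
    v: "v = (\<lambda>c'. if c' \<in> charts_at A p then jacobian c c' p y else 0)"
    using assms(4) by (auto simp: tb_point_def Let_def)
  have "p \<in> fst c"
    using assms(3) by (simp add: p chart_inv_def inv_into_into)
  have "jacobian c c' p (a *\<^sub>R y) = a *\<^sub>R jacobian c c' p y" if "c' \<in> charts_at A p" for c'
  proof -
    have c': "c' \<in> A" "p \<in> fst c'" using that by (auto simp: charts_at_def)
    then have "Ck_on (Suc 0) (snd c ` (fst c \<inter> fst c')) (transition c c')"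
      using assms(1,2) unfolding smooth_manifold_def smooth_on_def by blast
    then have "transition c c' differentiable (at (snd c p))"
      using \<open>p \<in> fst c\<close> c' by auto
    then show ?thesis
      unfolding jacobian_def using linear_frechet_derivative linear_scale by blast
  qed
  then show ?thesis
    by (auto simp: tb_point_def Let_def v simp flip: p)
qed

lemma coordinate_finsler_local_rep:
  assumes fm: "finsler_manifold X A D L" and c: "c \<in> A"
  shows "coordinate_finsler (local_domain A c D) (local_rep A c L)"
proof
  show "open (local_domain A c D)" "smooth_on (local_domain A c D) (local_rep A c L)"
    using fm c by (auto simp: finsler_manifold_def)
  show "invertible (g_mat (local_rep A c L) z)" if "z \<in> local_domain A c D" for z
    using fm c that by (auto simp: finsler_manifold_def)
  show "local_rep A c L z > 0" if "z \<in> local_domain A c D" for z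
    using fm that by (auto simp: finsler_manifold_def local_domain_def local_rep_def)
  fix x y and a :: real
  assume xy: "(x, y) \<in> local_domain A c D" and "a > 0"
  obtain p v where pv: "tb_point A c (x, y) = (p, v)" by fastforce
  have "tb_point A c (x, a *\<^sub>R y) = (p, \<lambda>c. a *\<^sub>R v c)"
    using fm c xy pv
    by (intro tb_point_scaleR) (auto simp: finsler_manifold_def local_domain_def)
  moreover have "(p, v) \<in> D"
    using xy pv by (simp add: local_domain_def)
  then have "L (p, \<lambda>c. a *\<^sub>R v c) = a * L (p, v)"
    using fm \<open>a > 0\<close> unfolding finsler_manifold_def by fast
  ultimately show "local_rep A c L (x, a *\<^sub>R y) = a * local_rep A c L (x, y)"
    by (simp add: local_rep_def pv)
qed

lemma tb_coords_in_local_domain: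
  assumes "finsler_manifold X A D L" "u \<in> D" "c \<in> charts_at A (fst u)"
  shows "tb_coords c u \<in> local_domain A c D"
proof -
  obtain p v where u: "u = (p, v)" by (cases u)
  have "is_chart X c" "v \<in> tangent_space A p"
    using assms unfolding finsler_manifold_def smooth_manifold_def slit_tangent_bundle_def
      charts_at_def u by auto
  from tb_point_tb_coords[OF this(1) _ this(2)] show ?thesis
    using assms u by (auto simp: local_domain_def tb_coords_def charts_at_def)
qed

theorem theorem4p4:
  fixes X :: "'m topology"
    and A :: "('m, 'n::finite) chart set"
    and D W :: "('m \<times> ('m, 'n) tvec) set"
    and L :: "'m \<times> ('m, 'n) tvec \<Rightarrow> real"
    and b :: "'m \<Rightarrow> ('m, 'n) chart \<Rightarrow> real ^ 'n"
  assumes "CARD('n) \<ge> 3"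
    and "finsler_manifold X A D L"
    and "smooth_one_form X A b"
    and "W \<subseteq> D"
    and "m_nonzero_on A L b W"
    and "semi_C_reducible_on A L W"
    and "b_condition_on A L b W"
  shows "riemannian_on A L W \<or> C2_like_on A L W"
proof -
  obtain r t where rt: "\<And>u. u \<in> W \<Longrightarrow> r u + t u = 1"
    and semi: "\<And>u c i j k. u \<in> W \<Longrightarrow> c \<in> charts_at A (fst u) \<Longrightarrow>
       cartan (local_rep A c L) (tb_coords c u) i j k =
        r u / (real CARD('n) + 1) *
          (h_low (local_rep A c L) (tb_coords c u) i j * cartan_vec (local_rep A c L) (tb_coords c u) k
         + h_low (local_rep A c L) (tb_coords c u) k i * cartan_vec (local_rep A c L) (tb_coords c u) j
         + h_low (local_rep A c L) (tb_coords c u) j k * cartan_vec (local_rep A c L) (tb_coords c u) i)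
        + t u / cartan_sq (local_rep A c L) (tb_coords c u)
          * cartan_vec (local_rep A c L) (tb_coords c u) i
          * cartan_vec (local_rep A c L) (tb_coords c u) j
          * cartan_vec (local_rep A c L) (tb_coords c u) k"
    using assms(6) unfolding semi_C_reducible_on_def Let_def by blast
  have "C2_like_on A L W"
    unfolding C2_like_on_def Let_def
  proof (intro ballI allI)
    fix u c i j k
    assume u: "u \<in> W" and c: "c \<in> charts_at A (fst u)"
    let ?F = "local_rep A c L" and ?z = "tb_coords c u" and ?b = "b (fst u) c"
    have "c \<in> A" using c by (simp add: charts_at_def)
    then interpret coordinate_finsler "local_domain A c D" ?F
      by (rule coordinate_finsler_local_rep[OF assms(2)])
    have z: "?z \<in> local_domain A c D"
      using tb_coords_in_local_domain assms(2,4) u c by blast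
    have bC: "(\<Sum>i\<in>UNIV. b_up ?F ?b ?z i * cartan ?F ?z i j k) = 0" for j k
      using assms(7) u c by (simp add: b_condition_on_def Let_def)
    obtain p where "m_low ?F ?b ?z p \<noteq> 0"
      using assms(5) u c by (auto simp: m_nonzero_on_def Let_def)
    then show "cartan_sq ?F ?z * cartan ?F ?z i j k
        = cartan_vec ?F ?z i * cartan_vec ?F ?z j * cartan_vec ?F ?z k"
      using C2_like_at[OF z semi[OF u c] rt[OF u] bC] by blast
  qed
  then show ?thesis ..
qed

end
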